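(* Let $(u,v)$ be a nonnegative classical solution of the Dirichlet problem $$\begin{cases}\Delta[(d_1+a_{11}u)u]+u(1-u-a_1v)=0, & x\in\Omega,\\ \Delta[(d_2+a_{22}v)v]+v(1-a_2u-v)=0, & x\in\Omega,\\ u=v=0, & x\in\partial\Omega.\end{cases}$$ If $u\not\equiv0$, then $u\le1$ in $\overline\Omega$. Similarly, if $v\not\equiv0$, then $v\le1$ in $\overline\Omega$.
   Context: $\Omega\subset\mathbb{R}^n$ ($n\ge1$) is a bounded domain with smooth boundary satisfying the interior ball condition at every boundary point. The constants satisfy $a_1,a_2,d_1,d_2>0$ and $a_{11},a_{22}\ge0$. A nonnegative classical solution is a pair $(u,v)\in (C^1(\overline\Omega)\cap C^2(\Omega))^2$ with $u,v\ge0$ in $\overline\Omega$ satisfying the system (equations and boundary conditions) pointwise. *)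

theory Defs
  imports "HOL-Analysis.Analysis"
begin

abbreviation dir_deriv :: "('a::euclidean_space \<Rightarrow> real) \<Rightarrow> 'a \<Rightarrow> 'a \<Rightarrow> real" where
  "dir_deriv f b x \<equiv> frechet_derivative f (at x) b"

text \<open>Meant for open \<open>S\<close> only: the derivatives are two-sided ones, taken at the points of \<open>S\<close>.\<close>

primrec Ck_on :: "nat \<Rightarrow> ('a::euclidean_space \<Rightarrow> real) \<Rightarrow> 'a set \<Rightarrow> bool" where
  "Ck_on 0 f S \<longleftrightarrow> continuous_on S f"
| "Ck_on (Suc k) f S \<longleftrightarrow>
     (\<forall>x\<in>S. f differentiable (at x)) \<and> (\<forall>b. Ck_on k (dir_deriv f b) S)"

definition smooth_on :: "('a::euclidean_space \<Rightarrow> real) \<Rightarrow> 'a set \<Rightarrow> bool" where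
  "smooth_on f S \<longleftrightarrow> (\<forall>k. Ck_on k f S)"

text \<open>The space \<open>C\<^sup>1\<close> of the closure of an open set: the function is continuous on the closure,
  \<open>C\<^sup>1\<close> on the open set itself, and its first derivatives extend continuously to the closure. The values
  of \<open>f\<close> outside the closure are irrelevant.\<close>

definition C1_closure :: "('a::euclidean_space \<Rightarrow> real) \<Rightarrow> 'a set \<Rightarrow> bool" where
  "C1_closure f \<Omega> \<longleftrightarrow>
     continuous_on (closure \<Omega>) f \<and> Ck_on 1 f \<Omega> \<and>
     (\<forall>b. \<exists>g. continuous_on (closure \<Omega>) g \<and> (\<forall>x\<in>\<Omega>. g x = dir_deriv f b x))"

definition laplacian :: "('a::euclidean_space \<Rightarrow> real) \<Rightarrow> 'a \<Rightarrow> real" where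
  "laplacian f x = (\<Sum>b\<in>Basis. dir_deriv (dir_deriv f b) b x)"

definition bounded_domain :: "'a::euclidean_space set \<Rightarrow> bool" where
  "bounded_domain \<Omega> \<longleftrightarrow> open \<Omega> \<and> connected \<Omega> \<and> \<Omega> \<noteq> {} \<and> bounded \<Omega>"

text \<open>Near each boundary point, after rotating or reflecting the coordinates so that the last one
  is in the direction of the unit vector \<open>e\<close>, \<open>\<Omega>\<close> is the part strictly above the graph of a smooth
  function \<open>\<gamma>\<close> of the other coordinates. A function on the hyperplane orthogonal to \<open>e\<close> is
  represented by a function on the whole space applied to the orthogonal projection.\<close>

definition smooth_boundary :: "'a::euclidean_space set \<Rightarrow> bool" where
  "smooth_boundary \<Omega> \<longleftrightarrow>
     (\<forall>\<xi>\<in>frontier \<Omega>. \<exists>r>0. \<exists>e \<gamma>. norm e = 1 \<and> smooth_on \<gamma> UNIV \<and>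
        \<Omega> \<inter> ball \<xi> r = {x \<in> ball \<xi> r. x \<bullet> e > \<gamma> (x - (x \<bullet> e) *\<^sub>R e)})"

definition interior_ball_condition :: "'a::euclidean_space set \<Rightarrow> bool" where
  "interior_ball_condition \<Omega> \<longleftrightarrow>
     (\<forall>\<xi>\<in>frontier \<Omega>. \<exists>c. \<exists>r>0. ball c r \<subseteq> \<Omega> \<and> \<xi> \<in> sphere c r)"

definition nonneg_classical_solution ::
  "'a::euclidean_space set \<Rightarrow> real \<Rightarrow> real \<Rightarrow> real \<Rightarrow> real \<Rightarrow> real \<Rightarrow> real \<Rightarrow>
   ('a \<Rightarrow> real) \<Rightarrow> ('a \<Rightarrow> real) \<Rightarrow> bool" where
  "nonneg_classical_solution \<Omega> a1 a2 d1 d2 a11 a22 u v \<longleftrightarrow>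
     C1_closure u \<Omega> \<and> Ck_on 2 u \<Omega> \<and>
     C1_closure v \<Omega> \<and> Ck_on 2 v \<Omega> \<and>
     (\<forall>x\<in>closure \<Omega>. u x \<ge> 0 \<and> v x \<ge> 0) \<and>
     (\<forall>x\<in>\<Omega>. laplacian (\<lambda>y. (d1 + a11 * u y) * u y) x + u x * (1 - u x - a1 * v x) = 0) \<and>
     (\<forall>x\<in>\<Omega>. laplacian (\<lambda>y. (d2 + a22 * v y) * v y) x + v x * (1 - a2 * u x - v x) = 0) \<and>
     (\<forall>x\<in>frontier \<Omega>. u x = 0 \<and> v x = 0)"

end

theory Submission
  imports Defs
begin

text \<open>The diffusion flux \<open>(d + a u) u\<close> is increasing in \<open>u \<ge> 0\<close>, so it is maximal where \<open>u\<close> is.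
  If \<open>max u > 1\<close>, the maximum is attained inside the domain, where the Laplacian of the flux is
  nonpositive and the reaction term \<open>u (1 - u - c v)\<close> is negative; their sum cannot vanish.\<close>

text \<open>By the chain rule, directional derivatives become derivatives of functions of one real
  variable. The parameter \<open>t\<close> is arbitrary because the mean value theorem will need the
  derivative at every point of a segment, not only at its starting point.\<close>

lemma has_real_derivative_along_line:
  fixes f :: "'a::euclidean_space \<Rightarrow> real"
  assumes "f differentiable (at (x + t *\<^sub>R b))"
  shows "((\<lambda>s. f (x + s *\<^sub>R b)) has_real_derivative dir_deriv f b (x + t *\<^sub>R b)) (at t)"
proof -
  let ?F = "frechet_derivative f (at (x + t *\<^sub>R b))"
  have f: "(f has_derivative ?F) (at (x + t *\<^sub>R b))"
    using assms frechet_derivative_works by blast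
  have "((\<lambda>s. x + s *\<^sub>R b) has_derivative (\<lambda>s. s *\<^sub>R b)) (at t)"
    by (auto intro!: derivative_eq_intros)
  from has_derivative_compose[OF this f]
  have "((\<lambda>s. f (x + s *\<^sub>R b)) has_derivative (\<lambda>s. ?F (s *\<^sub>R b))) (at t)" .
  moreover have "?F (s *\<^sub>R b) = ?F b * s" for s
    using linear_scale[OF has_derivative_linear[OF f]] by simp
  ultimately show ?thesis
    by (simp add: has_field_derivative_def)
qed

text \<open>At a maximum the first derivative along the line vanishes. If the second were positive,
  the first would be positive just beyond the point, and the mean value theorem would give a larger
  value there. Continuity of second derivatives does not enter this argument.\<close>

lemma second_dir_deriv_nonpos_at_max:
  fixes f :: "'a::euclidean_space \<Rightarrow> real"
  assumes "open S" and "x \<in> S"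
    and diff: "\<And>y. y \<in> S \<Longrightarrow> f differentiable (at y)"
    and diff2: "dir_deriv f b differentiable (at x)"
    and max: "\<And>y. y \<in> S \<Longrightarrow> f y \<le> f x"
  shows "dir_deriv (dir_deriv f b) b x \<le> 0"
proof (rule ccontr)
  assume pos: "\<not> ?thesis"
  \<comment> \<open>As long as the line stays in \<open>S\<close>, \<open>h\<close> is the
    derivative of \<open>g\<close>, so the derivative of \<open>h\<close> at 0 is the second
    directional derivative in question.\<close>
  define g where "g t = f (x + t *\<^sub>R b)" for t
  define h where "h t = dir_deriv f b (x + t *\<^sub>R b)" for t
  have "open ((\<lambda>t. x + t *\<^sub>R b) -` S)"
    by (rule open_vimage[OF \<open>open S\<close>]) (auto intro!: continuous_intros)
  moreover have "0 \<in> (\<lambda>t. x + t *\<^sub>R b) -` S"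
    using \<open>x \<in> S\<close> by simp
  ultimately obtain e where "e > 0" and ball: "ball 0 e \<subseteq> (\<lambda>t. x + t *\<^sub>R b) -` S"
    using openE by blast
  have e: "x + t *\<^sub>R b \<in> S" if "\<bar>t\<bar> < e" for t
    using subsetD[OF ball, of t] that by (simp add: dist_real_def)
  have g: "(g has_real_derivative h t) (at t)" if "\<bar>t\<bar> < e" for t
    unfolding g_def h_def using that e diff has_real_derivative_along_line by blast
  have g_max: "g t \<le> g 0" if "\<bar>t\<bar> < e" for t
    using max e[OF that] by (simp add: g_def)
  have "h 0 = 0"
    using DERIV_local_max[OF g \<open>e > 0\<close>] g_max \<open>e > 0\<close> by simp
  have "(h has_real_derivative dir_deriv (dir_deriv f b) b x) (at 0)"
    using has_real_derivative_along_line[of "dir_deriv f b" x 0 b] diff2 by (simp add: h_def[abs_def])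
  then obtain d where "d > 0" and d: "\<And>t. 0 < t \<Longrightarrow> t < d \<Longrightarrow> 0 < h t"
    using DERIV_pos_inc_right[of h _ 0] pos \<open>h 0 = 0\<close> by force
  \<comment> \<open>Halving the minimum puts \<open>s\<close> strictly inside both ranges:
    \<open>h\<close> is positive on all of (0, \<open>s\<close>], and \<open>g s\<close> is still
    bounded by \<open>g 0\<close>.\<close>
  define s where "s = min d e / 2"
  have s: "0 < s" "s < d" "s < e"
    using \<open>d > 0\<close> \<open>e > 0\<close> by (auto simp: s_def min_def)
  obtain t where "0 < t" "t < s" and mvt: "g s - g 0 = (s - 0) * h t"
    using MVT2[of 0 s g h] s g by force
  then have "s * h t > 0"
    using d s by simp
  then show False
    using mvt g_max[of s] s by simp
qed

lemma laplacian_nonpos_at_max: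
  fixes f :: "'a::euclidean_space \<Rightarrow> real"
  assumes "open S" and "x \<in> S"
    and "\<And>y. y \<in> S \<Longrightarrow> f differentiable (at y)"
    and "\<And>b. dir_deriv f b differentiable (at x)"
    and "\<And>y. y \<in> S \<Longrightarrow> f y \<le> f x"
  shows "laplacian f x \<le> 0"
  unfolding laplacian_def
  by (intro sum_nonpos second_dir_deriv_nonpos_at_max[OF assms(1,2)] assms)

text \<open>The flux is \<open>u\<close> followed by the map taking s to (d + a s) s, whose
  derivative is d + 2 a s.\<close>

lemma dir_deriv_flux:
  fixes u :: "'a::euclidean_space \<Rightarrow> real"
  assumes "u differentiable (at y)"
  shows "dir_deriv (\<lambda>z. (d + a * u z) * u z) b y = (d + 2 * a * u y) * dir_deriv u b y"
proof -
  have "(u has_derivative frechet_derivative u (at y)) (at y)"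
    using assms frechet_derivative_works by blast
  then have "((\<lambda>z. (d + a * u z) * u z) has_derivative
      (\<lambda>b. (d + 2 * a * u y) * dir_deriv u b y)) (at y)"
    by (auto intro!: derivative_eq_intros simp: algebra_simps)
  from frechet_derivative_at[OF this] show ?thesis
    by metis
qed

lemma flux_differentiable:
  fixes u :: "'a::euclidean_space \<Rightarrow> real"
  assumes "u differentiable (at y)"
  shows "(\<lambda>z. (d + a * u z) * u z) differentiable (at y)"
  using assms by (intro derivative_intros)

lemma dir_deriv_flux_differentiable:
  fixes u :: "'a::euclidean_space \<Rightarrow> real"
  assumes "open S" and "x \<in> S" and "Ck_on 2 u S"
  shows "dir_deriv (\<lambda>z. (d + a * u z) * u z) b differentiable (at x)"
proof -
  have u: "u differentiable (at y)" "dir_deriv u b differentiable (at y)" if "y \<in> S" for y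
    using assms(3) that by (auto simp: numeral_2_eq_2)
  have "(\<lambda>y. (d + 2 * a * u y) * dir_deriv u b y) differentiable (at x)"
    using u[OF \<open>x \<in> S\<close>] by (intro derivative_intros)
  then obtain D where "((\<lambda>y. (d + 2 * a * u y) * dir_deriv u b y) has_derivative D) (at x)"
    unfolding differentiable_def by blast
  \<comment> \<open>The product formula holds on all of the open set \<open>S\<close>, not just at
    \<open>x\<close>, so differentiability of the product at \<open>x\<close> carries over to the
    derivative of the flux.\<close>
  then have "(dir_deriv (\<lambda>z. (d + a * u z) * u z) b has_derivative D) (at x)"
    by (rule has_derivative_transform_within_open[OF _ assms(1,2)]) (simp add: dir_deriv_flux u)
  then show ?thesis
    unfolding differentiable_def by blast
qed

text \<open>Here the other component \<open>v\<close> is merely a nonnegative coefficient in a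
  scalar equation for \<open>u\<close>. This makes one argument serve both components, with their
  roles exchanged.\<close>

lemma cross_diffusion_component_le_one:
  fixes u v :: "'a::euclidean_space \<Rightarrow> real"
  assumes "open \<Omega>" and "bounded \<Omega>" and "d > 0" and "a \<ge> 0" and "c \<ge> 0"
    and cont: "continuous_on (closure \<Omega>) u" and C2: "Ck_on 2 u \<Omega>"
    and nonneg: "\<And>x. x \<in> closure \<Omega> \<Longrightarrow> u x \<ge> 0" "\<And>x. x \<in> \<Omega> \<Longrightarrow> v x \<ge> 0"
    and eq: "\<And>x. x \<in> \<Omega> \<Longrightarrow>
      laplacian (\<lambda>y. (d + a * u y) * u y) x + u x * (1 - u x - c * v x) = 0"
    and bdry: "\<And>x. x \<in> frontier \<Omega> \<Longrightarrow> u x \<le> 1"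
    and z: "z \<in> closure \<Omega>"
  shows "u z \<le> 1"
proof (rule ccontr)
  assume "\<not> u z \<le> 1"
  have "compact (closure \<Omega>)"
    using \<open>bounded \<Omega>\<close> by (simp add: compact_closure)
  then have "\<exists>x\<in>closure \<Omega>. \<forall>y\<in>closure \<Omega>. u y \<le> u x"
    using z by (intro continuous_attains_sup[OF _ _ cont]) auto
  then obtain x where x: "x \<in> closure \<Omega>" and max: "\<And>y. y \<in> closure \<Omega> \<Longrightarrow> u y \<le> u x"
    by blast
  have "u x > 1"
    using \<open>\<not> u z \<le> 1\<close> max[OF z] by simp
  then have "x \<in> \<Omega>"
    using bdry[of x] x \<open>open \<Omega>\<close> by (auto simp: frontier_def interior_open)
  have "laplacian (\<lambda>y. (d + a * u y) * u y) x \<le> 0"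
  proof (rule laplacian_nonpos_at_max[OF \<open>open \<Omega>\<close> \<open>x \<in> \<Omega>\<close>])
    show "(\<lambda>y. (d + a * u y) * u y) differentiable (at y)" if "y \<in> \<Omega>" for y
      using C2 that by (intro flux_differentiable) (auto simp: numeral_2_eq_2)
    show "dir_deriv (\<lambda>y. (d + a * u y) * u y) b differentiable (at x)" for b
      by (rule dir_deriv_flux_differentiable[OF \<open>open \<Omega>\<close> \<open>x \<in> \<Omega>\<close> C2])
    \<comment> \<open>Both factors of the flux are nonnegative and nondecreasing in the value of
      \<open>u\<close>, so a maximum point of \<open>u\<close> is one of the flux.\<close>
    show "(d + a * u y) * u y \<le> (d + a * u x) * u x" if "y \<in> \<Omega>" for y
    proof -
      have "y \<in> closure \<Omega>"
        using that closure_subset by blast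
      then have "0 \<le> u y" "u y \<le> u x"
        using nonneg max by auto
      then show ?thesis
        using \<open>d > 0\<close> \<open>a \<ge> 0\<close> by (intro mult_mono add_mono) auto
    qed
  qed
  moreover have "c * v x \<ge> 0"
    using \<open>c \<ge> 0\<close> nonneg(2)[OF \<open>x \<in> \<Omega>\<close>] by simp
  \<comment> \<open>The first factor exceeds 1, and the second is at most 1 - \<open>u x\<close>,
    hence negative.\<close>
  then have "u x * (1 - u x - c * v x) < 0"
    using \<open>u x > 1\<close> by (intro mult_pos_neg) auto
  ultimately show False
    using eq[OF \<open>x \<in> \<Omega>\<close>] by simp
qed

theorem lemma3p2:
  fixes \<Omega> :: "(real ^ 'n) set"
    and a1 a2 d1 d2 a11 a22 :: real
    and u v :: "real ^ 'n \<Rightarrow> real"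
  assumes "bounded_domain \<Omega>" and "smooth_boundary \<Omega>" and "interior_ball_condition \<Omega>"
    and "a1 > 0" and "a2 > 0" and "d1 > 0" and "d2 > 0" and "a11 \<ge> 0" and "a22 \<ge> 0"
    and "nonneg_classical_solution \<Omega> a1 a2 d1 d2 a11 a22 u v"
  shows "((\<exists>x\<in>closure \<Omega>. u x \<noteq> 0) \<longrightarrow> (\<forall>x\<in>closure \<Omega>. u x \<le> 1)) \<and>
         ((\<exists>x\<in>closure \<Omega>. v x \<noteq> 0) \<longrightarrow> (\<forall>x\<in>closure \<Omega>. v x \<le> 1))"
proof -
  have \<Omega>: "open \<Omega>" "bounded \<Omega>"
    using assms(1) by (auto simp: bounded_domain_def)
  have u: "continuous_on (closure \<Omega>) u" "Ck_on 2 u \<Omega>"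
    and v: "continuous_on (closure \<Omega>) v" "Ck_on 2 v \<Omega>"
    and nonneg: "\<And>x. x \<in> closure \<Omega> \<Longrightarrow> u x \<ge> 0" "\<And>x. x \<in> closure \<Omega> \<Longrightarrow> v x \<ge> 0"
    and u_eq: "\<And>x. x \<in> \<Omega> \<Longrightarrow>
      laplacian (\<lambda>y. (d1 + a11 * u y) * u y) x + u x * (1 - u x - a1 * v x) = 0"
    and v_eq: "\<And>x. x \<in> \<Omega> \<Longrightarrow>
      laplacian (\<lambda>y. (d2 + a22 * v y) * v y) x + v x * (1 - a2 * u x - v x) = 0"
    and bdry: "\<And>x. x \<in> frontier \<Omega> \<Longrightarrow> u x \<le> 1" "\<And>x. x \<in> frontier \<Omega> \<Longrightarrow> v x \<le> 1"
    using assms(10) unfolding nonneg_classical_solution_def C1_closure_def by simp_all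
  note nonneg' = nonneg[OF subsetD[OF closure_subset]]
  \<comment> \<open>Swapping the two subtracted terms gives the equation for \<open>v\<close> the
    shape of the scalar lemma, with \<open>a2\<close> as \<open>c\<close> and \<open>u\<close> as
    the coefficient.\<close>
  have v_eq': "laplacian (\<lambda>y. (d2 + a22 * v y) * v y) x + v x * (1 - v x - a2 * u x) = 0"
    if "x \<in> \<Omega>" for x
    using v_eq[OF that] unfolding cancel_ab_semigroup_add_class.diff_right_commute[of 1 "v x" "a2 * u x"] .
  have "u x \<le> 1" if "x \<in> closure \<Omega>" for x
    using cross_diffusion_component_le_one[OF \<Omega> \<open>d1 > 0\<close> \<open>a11 \<ge> 0\<close> less_imp_le[OF \<open>a1 > 0\<close>]
        u nonneg(1) nonneg'(2) u_eq bdry(1) that] .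
  moreover have "v x \<le> 1" if "x \<in> closure \<Omega>" for x
    using cross_diffusion_component_le_one[OF \<Omega> \<open>d2 > 0\<close> \<open>a22 \<ge> 0\<close> less_imp_le[OF \<open>a2 > 0\<close>]
        v nonneg(2) nonneg'(1) v_eq' bdry(2) that] .
  ultimately show ?thesis
    by blast
qed

end
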